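(* Let $n\ge 1$, let $M_n=\{p_1,\dots,p_n\}$ be the set of the first $n$ primes, and let $p_j\in M_n$. For every integer $K\ge 1$, $$f_{M_n}\!\left(K\cdot\frac{\prod_{1\le i\le n}p_i}{p_j-1}\right) = f_{M_n-p_j}\!\left(K\cdot\prod_{p_i\in M_n-p_j}p_i\right).$$
   Context: $p_i$ denotes the $i$-th prime number. $M_n-p_j$ denotes the set $M_n\setminus\{p_j\}$. For a finite set $S$ of primes and a real number $x\ge 0$, $f_S(x)$ denotes the number of positive integers $\le x$ that are not divisible by any prime in $S$. An empty product equals $1$. *)

theory Defs
  imports Complex_Main "HOL-Library.Infinite_Set" "HOL-Computational_Algebra.Primes"
begin

text \<open>
  Primes are indexed from 1, so \<open>nth_prime 1 = 2\<close>; \<^const>\<open>enumerate\<close> counts from 0.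
  The value at index 0 is junk (it equals 2) and is never used.
\<close>

definition nth_prime :: "nat \<Rightarrow> nat" where
  "nth_prime i = enumerate {p. prime p} (i - 1)"

definition first_primes :: "nat \<Rightarrow> nat set" where
  "first_primes n = nth_prime ` {1..n}"

definition sieve_count :: "nat set \<Rightarrow> real \<Rightarrow> nat" where
  "sieve_count S x = card {m :: nat. 0 < m \<and> real m \<le> x \<and> (\<forall>p\<in>S. \<not> p dvd m)}"

end

theory Submission
  imports Defs
begin

text \<open>
  Write \<open>q = p\<^sub>j\<close>, let \<open>S = M\<^sub>n - p\<^sub>j\<close> and let \<open>N\<close> be \<open>K\<close> times the product of \<open>S\<close>. Among the numbers up
  to \<open>x\<close> free of primes in \<open>S\<close>, the multiples of \<open>q\<close> correspond to those up to \<open>x / q\<close>, so the sieve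
  by \<open>M\<^sub>n\<close> counts \<open>f\<^sub>S(x) - f\<^sub>S(x / q)\<close>. Since \<open>N\<close> is a period of the sieve by \<open>S\<close>,
  \<open>f\<^sub>S(N + y) = f\<^sub>S(N) + f\<^sub>S(y)\<close>. For \<open>x = N q / (q - 1)\<close> and \<open>y = x / q\<close> one has \<open>x = N + y\<close>, and
  the two terms \<open>f\<^sub>S(x / q)\<close> cancel.
\<close>

lemma finite_nat_real_le: "finite {m :: nat. 0 < m \<and> real m \<le> x \<and> P m}"
  by (rule finite_subset[of _ "{..nat \<lfloor>x\<rfloor>}"]) (auto simp: le_nat_floor)

text \<open>Cut the counted numbers at \<open>N\<close>: those beyond it are the translates by
  \<open>N\<close> of the numbers counted up to \<open>y\<close>, because adding a common multiple
  of \<open>S\<close> changes no divisibility by a member of \<open>S\<close>.\<close>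

lemma sieve_count_add_period:
  fixes N :: nat
  assumes "y \<ge> 0" and period: "\<And>p. p \<in> S \<Longrightarrow> p dvd N"
  shows "sieve_count S (real N + y) = sieve_count S (real N) + sieve_count S y"
proof -
  define F where "F x = {m :: nat. 0 < m \<and> real m \<le> x \<and> (\<forall>p\<in>S. \<not> p dvd m)}" for x
  have dvd: "p dvd N + m \<longleftrightarrow> p dvd m" if "p \<in> S" for p m
    using period[OF that] by (simp add: dvd_add_right_iff)
  have "F (real N + y) = F (real N) \<union> (+) N ` F y"
  proof (intro equalityI subsetI)
    fix m assume m: "m \<in> F (real N + y)"
    show "m \<in> F (real N) \<union> (+) N ` F y"
    proof (cases "m \<le> N")
      case True
      with m show ?thesis by (simp add: F_def)
    next
      case False
      then have m_eq: "m = N + (m - N)" and "0 < m - N" by auto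
      moreover have "\<not> p dvd m - N" if "p \<in> S" for p
        using m that dvd[OF that, of "m - N"] False by (simp add: F_def)
      ultimately have "m - N \<in> F y"
        using m by (auto simp: F_def of_nat_diff)
      with m_eq show ?thesis by blast
    qed
  \<comment> \<open>The sign of \<open>y\<close> gives
    \<open>F (real N) \<subseteq> F (real N + y)\<close>.\<close>
  qed (use \<open>y \<ge> 0\<close> dvd in \<open>auto simp: F_def\<close>)
  moreover have "F (real N) \<inter> (+) N ` F y = {}"
    by (auto simp: F_def)
  moreover have "finite (F x)" for x
    unfolding F_def by (rule finite_nat_real_le)
  ultimately have "card (F (real N + y)) = card (F (real N)) + card (F y)"
    by (simp add: card_Un_disjoint card_image)
  then show ?thesis
    by (simp add: sieve_count_def F_def)
qed

text \<open>The numbers that \<open>q\<close> newly sieves out are the \<open>q * k\<close> with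
  \<open>k\<close> free of primes in \<open>S\<close> and at most \<open>x / q\<close>: a prime
  other than \<open>q\<close> divides \<open>q * k\<close> only if it divides
  \<open>k\<close>.\<close>

lemma sieve_count_insert_prime:
  assumes "prime q" and "\<And>p. p \<in> S \<Longrightarrow> prime p" and "q \<notin> S"
  shows "sieve_count S x = sieve_count (insert q S) x + sieve_count S (x / real q)"
proof -
  define F where "F T z = {m :: nat. 0 < m \<and> real m \<le> z \<and> (\<forall>p\<in>T. \<not> p dvd m)}" for T z
  have q: "q > 0"
    using \<open>prime q\<close> by (rule prime_gt_0_nat)
  have dvd: "p dvd q * m \<longleftrightarrow> p dvd m" if "p \<in> S" for p m
    using that assms primes_dvd_imp_eq[of p q] by (auto simp: prime_dvd_mult_iff)
  have mult: "q * k \<in> F S x \<longleftrightarrow> k \<in> F S (x / real q)" for k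
    using q dvd by (auto simp: F_def field_simps)
  have "F S x = F (insert q S) x \<union> (*) q ` F S (x / real q)"
  proof (intro equalityI subsetI)
    fix m assume m: "m \<in> F S x"
    show "m \<in> F (insert q S) x \<union> (*) q ` F S (x / real q)"
    proof (cases "q dvd m")
      case True
      then obtain k where "m = q * k" ..
      with m mult show ?thesis by blast
    next
      case False
      with m show ?thesis by (simp add: F_def)
    qed
  next
    fix m assume "m \<in> F (insert q S) x \<union> (*) q ` F S (x / real q)"
    then show "m \<in> F S x"
    proof
      assume "m \<in> F (insert q S) x"
      then show ?thesis by (simp add: F_def)
    next
      assume "m \<in> (*) q ` F S (x / real q)"
      with mult show ?thesis by blast
    qed
  qed
  moreover have "F (insert q S) x \<inter> (*) q ` F S (x / real q) = {}"
    by (auto simp: F_def)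
  moreover have "finite (F T z)" for T z
    unfolding F_def by (rule finite_nat_real_le)
  moreover have "inj_on ((*) q) (F S (x / real q))"
    using q by (auto intro: inj_onI)
  ultimately have "card (F S x) = card (F (insert q S) x) + card (F S (x / real q))"
    by (simp add: card_Un_disjoint card_image)
  then show ?thesis
    by (simp add: sieve_count_def F_def)
qed

lemma prime_nth_prime: "prime (nth_prime i)"
  using enumerate_in_set[OF primes_infinite, of "i - 1"] by (simp add: nth_prime_def)

lemma inj_on_nth_prime: "inj_on nth_prime {1..n}"
proof (rule inj_onI)
  fix i k assume "i \<in> {1..n}" "k \<in> {1..n}" and "nth_prime i = nth_prime k"
  moreover have "inj (enumerate {p :: nat. prime p})"
    using strict_mono_enumerate[OF primes_infinite] by (rule strict_mono_imp_inj_on)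
  \<comment> \<open>Truncated subtraction sends the indices 0 and 1 to the same prime; on
    \<open>{1..n}\<close> the map \<open>i - 1\<close> is injective.\<close>
  ultimately show "i = k"
    by (auto simp: nth_prime_def dest: injD)
qed

theorem theorem9:
  fixes n j K :: nat
  assumes "n \<ge> 1" and "j \<in> {1..n}" and "K \<ge> 1"
  shows "sieve_count (first_primes n)
           (real K * ((\<Prod>i=1..n. real (nth_prime i)) / (real (nth_prime j) - 1)))
       = sieve_count (first_primes n - {nth_prime j})
           (real K * (\<Prod>p\<in>first_primes n - {nth_prime j}. real p))"
proof -
  define q where "q = nth_prime j"
  define S where "S = first_primes n - {q}"
  define N where "N = K * \<Prod>S"
  define y where "y = real N / (real q - 1)"
  have q: "prime q"
    by (simp add: q_def prime_nth_prime)
  then have q1: "real q > 1"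
    using prime_gt_1_nat by force
  have q_in: "q \<in> first_primes n"
    using assms(2) by (auto simp: q_def first_primes_def)
  have fin: "finite (first_primes n)"
    by (simp add: first_primes_def)
  have primes: "prime p" if "p \<in> S" for p
    using that by (auto simp: S_def first_primes_def prime_nth_prime)
  have "(\<Prod>i=1..n. real (nth_prime i)) = (\<Prod>p\<in>first_primes n. real p)"
    unfolding first_primes_def by (subst prod.reindex[OF inj_on_nth_prime]) simp
  also have "\<dots> = real q * real (\<Prod>S)"
    using prod.remove[OF fin q_in, of real] by (simp add: S_def)
  finally have prod_eq: "(\<Prod>i=1..n. real (nth_prime i)) = real q * real (\<Prod>S)" .
  \<comment> \<open>The left side is \<open>N * q / (q - 1)\<close>, and
    \<open>q / (q - 1) = 1 + 1 / (q - 1)\<close>.\<close>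
  have x: "real K * ((\<Prod>i=1..n. real (nth_prime i)) / (real q - 1)) = real N + y"
    unfolding prod_eq using q1 by (simp add: y_def N_def field_simps)
  \<comment> \<open>This fixed-point equation determines \<open>y\<close>: the multiples of
    \<open>q\<close> removed up to \<open>N + y\<close> are as many as the numbers gained beyond
    \<open>N\<close>.\<close>
  have y_eq: "(real N + y) / real q = y"
    using q1 by (simp add: y_def field_simps)
  have "p dvd N" if "p \<in> S" for p
    using that fin by (auto simp: N_def S_def intro!: dvd_mult dvd_prodI)
  moreover have "y \<ge> 0"
    using q1 by (simp add: y_def)
  ultimately have "sieve_count S (real N + y) = sieve_count S (real N) + sieve_count S y"
    by (intro sieve_count_add_period)
  moreover have "sieve_count S (real N + y)
      = sieve_count (insert q S) (real N + y) + sieve_count S ((real N + y) / real q)"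
    by (rule sieve_count_insert_prime) (use q primes in \<open>auto simp: S_def\<close>)
  moreover have "insert q S = first_primes n"
    using q_in by (auto simp: S_def)
  ultimately have "sieve_count (first_primes n) (real N + y) = sieve_count S (real N)"
    by (simp only: y_eq)
  moreover have "real N = real K * (\<Prod>p\<in>S. real p)"
    by (simp add: N_def)
  ultimately show ?thesis
    unfolding q_def[symmetric] S_def[symmetric] x by simp
qed

end
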